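(* Consider the iterates generated by the subspace framework described in the context. Suppose that the iterates $\nu^{(\ell)}$ and $\nu^{(k)}$ are equal for some integers $\ell,k$ such that $1\le\ell<k$. Then $\nu^{(\ell)}$ is a global minimizer of $\alpha_\epsilon(\nu)$ over all $\nu\in\underline{\Omega}$.
   Context: Setting. Let $\Omega\subseteq\mathbb{R}^d$ be open, $\underline{\Omega}\subseteq\Omega$ compact, $\epsilon>0$, and let $w=(w_m,w_c,w_k)$ be nonnegative real weights. Consider the parameter-dependent quadratic matrix polynomial $P(\lambda;\nu)=\lambda^2M(\nu)+\lambda C(\nu)+K(\nu)$, $\nu\in\Omega$, where $M(\nu)=\sum_i\psi_i(\nu)M_i$, $C(\nu)=\sum_j\zeta_j(\nu)C_j$, $K(\nu)=\sum_\ell\kappa_\ell(\nu)K_\ell$ are finite sums with given matrices $M_i,C_j,K_\ell\in\mathbb{C}^{n\times n}$ and real-analytic functions $\psi_i,\zeta_j,\kappa_\ell:\Omega\to\mathbb{R}$. Let $p_w(z):=\sqrt{w_m^2z^4+w_c^2z^2+w_k^2}$ and let $\sigma_{\min}(A)$ be the smallest singular value of $A$. Pseudospectra. $\Lambda_\epsilon(\nu):=\{\lambda\in\mathbb{C}\mid\sigma_{\min}(P(\lambda;\nu))\le\epsilon\,p_w(|\lambda|)\}$ and $\alpha_\epsilon(\nu):=\sup\{\mathrm{Re}(z)\mid z\in\Lambda_\epsilon(\nu)\}$. For a subspace $\mathcal{V}$ of $\mathbb{C}^n$ and a matrix $V$ whose columns form an orthonormal basis of $\mathcal{V}$, let $P^V(\lambda;\nu):=P(\lambda;\nu)V$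 and $\alpha^{\mathcal V}_\epsilon(\nu):=\sup\{\mathrm{Re}(z)\mid z\in\mathbb{C},\ \sigma_{\min}(P^V(z;\nu))\le\epsilon\,p_w(|z|)\}$ (independent of the choice of $V$). A rightmost point of $\Lambda_\epsilon(\nu)$ is a $z\in\Lambda_\epsilon(\nu)$ with $\mathrm{Re}(z)=\alpha_\epsilon(\nu)$. Standing assumption: $\Lambda_\epsilon(\nu)$ is bounded for all $\nu\in\underline{\Omega}$. Subspace framework. Initialization: choose points $\nu^{(0)}_1,\dots,\nu^{(0)}_\eta\in\underline{\Omega}$; for each $j$ let $z^{(0)}_j$ be a rightmost point in $\Lambda_\epsilon(\nu^{(0)}_j)$ and $v^{(0)}_j$ a right singular vector corresponding to $\sigma_{\min}(P(z^{(0)}_j;\nu^{(0)}_j))$; let the columns of $V_0$ form an orthonormal basis for $\mathrm{span}\{v^{(0)}_1,\dots,v^{(0)}_\eta\}$. For $k=1,2,\dots$: let $\nu^{(k)}$ be a global minimizer of $\alpha^{\mathcal{V}_{k-1}}_\epsilon(\nu)$ over $\nu\in\underline{\Omega}$; let $z^{(k)}$ be a rightmost point in $\Lambda_\epsilon(\nu^{(k)})$; let $v^{(k)}$ be a right singular vector corresponding to $\sigma_{\min}(P(z^{(k)};\nu^{(k)}))$; and let the columns of $V_k$ form an orthonormal basis for the span of the columns of $[V_{k-1}\ \ v^{(k)}]$. Here $\mathcal{V}_k:=\mathrm{Col}(V_k)$ is the column space of $V_k$. *)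

theory Defs
  imports
    "HOL-Analysis.Analysis"
    "Jordan_Normal_Form.Schur_Decomposition"
    "Jordan_Normal_Form.VS_Connect"
begin

unbundle no inner_syntax and no vec_syntax

text \<open>
  The parameter space is \<open>real ^ 'd\<close>. Matrices and vectors over the complex numbers are those of
  \<^theory>\<open>Jordan_Normal_Form.Matrix\<close>, because the number of columns of the projection matrices
  changes during the iteration.
\<close>

text \<open>
  As \<open>'d\<close> is finite, \<open>'d \<Rightarrow> nat\<close> is the type of multi-indices. The family of monomials is summed
  unconditionally, i.e. absolutely.
\<close>

definition real_analytic_on :: "(real ^ 'd \<Rightarrow> real) \<Rightarrow> (real ^ 'd) set \<Rightarrow> bool" where
  "real_analytic_on f S \<longleftrightarrow>
    (\<forall>x\<in>S. \<exists>r>0. ball x r \<subseteq> S \<and>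
      (\<exists>a :: ('d \<Rightarrow> nat) \<Rightarrow> real. \<forall>y\<in>ball x r.
        ((\<lambda>m. a m * (\<Prod>i\<in>UNIV. (vec_nth y i - vec_nth x i) ^ m i)) has_sum f y) UNIV))"

text \<open>
  Both vectors are required to be unit vectors, also for \<open>s = 0\<close>. Hence \<open>0\<close> is a singular value
  of an \<open>m \<times> r\<close> matrix iff both the matrix and its adjoint have a nontrivial kernel, i.e. iff its
  rank is less than \<open>min m r\<close>. So the singular values are exactly the (at most \<open>min m r\<close>) diagonal
  entries in a singular value decomposition.
\<close>

definition singular_triple :: "complex mat \<Rightarrow> real \<Rightarrow> complex vec \<Rightarrow> complex vec \<Rightarrow> bool" where
  "singular_triple A s u v \<longleftrightarrow>
    s \<ge> 0 \<and> u \<in> carrier_vec (dim_row A) \<and> v \<in> carrier_vec (dim_col A) \<and>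
    u \<bullet>c u = 1 \<and> v \<bullet>c v = 1 \<and>
    A *\<^sub>v v = complex_of_real s \<cdot>\<^sub>v u \<and>
    mat_adjoint A *\<^sub>v u = complex_of_real s \<cdot>\<^sub>v v"

definition sigma_min :: "complex mat \<Rightarrow> real" where
  "sigma_min A = Min {s. \<exists>u v. singular_triple A s u v}"

definition min_right_singular_vector :: "complex mat \<Rightarrow> complex vec \<Rightarrow> bool" where
  "min_right_singular_vector A v \<longleftrightarrow> (\<exists>u. singular_triple A (sigma_min A) u v)"

text \<open>\<open>(\<Sum>i<q. f i \<nu> * A i)\<close> for \<open>n \<times> n\<close> matrices \<open>A i\<close>, written entrywise.\<close>

definition param_mat ::
    "nat \<Rightarrow> nat \<Rightarrow> (nat \<Rightarrow> 'p \<Rightarrow> real) \<Rightarrow> (nat \<Rightarrow> complex mat) \<Rightarrow> 'p \<Rightarrow> complex mat" where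
  "param_mat n q f A \<nu> =
    mat n n (\<lambda>(a, b). \<Sum>i<q. complex_of_real (f i \<nu>) * (A i $$ (a, b)))"

definition quad_matpoly ::
    "('p \<Rightarrow> complex mat) \<Rightarrow> ('p \<Rightarrow> complex mat) \<Rightarrow> ('p \<Rightarrow> complex mat)
      \<Rightarrow> complex \<Rightarrow> 'p \<Rightarrow> complex mat" where
  "quad_matpoly M C K z \<nu> = z\<^sup>2 \<cdot>\<^sub>m M \<nu> + z \<cdot>\<^sub>m C \<nu> + K \<nu>"

definition p_weight :: "real \<times> real \<times> real \<Rightarrow> real \<Rightarrow> real" where
  "p_weight w x = (case w of (wm, wc, wk) \<Rightarrow> sqrt (wm\<^sup>2 * x ^ 4 + wc\<^sup>2 * x\<^sup>2 + wk\<^sup>2))"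

text \<open>
  In the next three definitions \<open>P\<close> is either the square matrix polynomial or its reduction
  \<open>P\<^sup>V\<close> with rectangular values.
\<close>

definition pseudospectrum ::
    "(complex \<Rightarrow> 'p \<Rightarrow> complex mat) \<Rightarrow> real \<Rightarrow> real \<times> real \<times> real \<Rightarrow> 'p \<Rightarrow> complex set" where
  "pseudospectrum P \<epsilon> w \<nu> = {z. sigma_min (P z \<nu>) \<le> \<epsilon> * p_weight w (cmod z)}"

text \<open>
  The supremum is taken in the extended reals, since the pseudospectrum of a reduced problem may be
  empty (supremum \<open>-\<infinity>\<close>).
\<close>

definition pseudospectral_abscissa ::
    "(complex \<Rightarrow> 'p \<Rightarrow> complex mat) \<Rightarrow> real \<Rightarrow> real \<times> real \<times> real \<Rightarrow> 'p \<Rightarrow> ereal" where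
  "pseudospectral_abscissa P \<epsilon> w \<nu> = (SUP z\<in>pseudospectrum P \<epsilon> w \<nu>. ereal (Re z))"

definition rightmost_point ::
    "(complex \<Rightarrow> 'p \<Rightarrow> complex mat) \<Rightarrow> real \<Rightarrow> real \<times> real \<times> real \<Rightarrow> 'p \<Rightarrow> complex \<Rightarrow> bool" where
  "rightmost_point P \<epsilon> w \<nu> z \<longleftrightarrow>
    z \<in> pseudospectrum P \<epsilon> w \<nu> \<and> ereal (Re z) = pseudospectral_abscissa P \<epsilon> w \<nu>"

definition reduced_matpoly ::
    "(complex \<Rightarrow> 'p \<Rightarrow> complex mat) \<Rightarrow> complex mat \<Rightarrow> complex \<Rightarrow> 'p \<Rightarrow> complex mat" where
  "reduced_matpoly P V z \<nu> = P z \<nu> * V"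

abbreviation cspan :: "nat \<Rightarrow> complex vec set \<Rightarrow> complex vec set" where
  "cspan n S \<equiv> LinearCombinations.module.span class_ring (module_vec TYPE(complex) n) S"

definition onb_matrix :: "nat \<Rightarrow> complex mat \<Rightarrow> complex vec set \<Rightarrow> bool" where
  "onb_matrix n V \<V> \<longleftrightarrow>
    dim_row V = n \<and> mat_adjoint V * V = 1\<^sub>m (dim_col V) \<and> cspan n (set (cols V)) = \<V>"

end

theory Submission
  imports Defs "Jordan_Normal_Form.Spectral_Radius"
begin

text \<open>
  For a matrix with at least as many rows as columns, \<open>sigma_min\<close> is the minimum of \<open>\<parallel>A x\<parallel>\<close> over unit
  vectors \<open>x\<close>. Restricting \<open>x\<close> to a subspace can only increase it, so the reduced abscissa is a lower
  bound for the full one at every parameter. Since \<open>v l\<close> belongs to the subspace of step \<open>k - 1\<close>, the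
  rightmost point at \<open>\<nu> l\<close> survives the reduction and both abscissae agree at \<open>\<nu> l = \<nu> k\<close>. As this
  point minimizes the lower bound, it minimizes the full abscissa.

  The variational characterization of \<open>sigma_min\<close> is obtained without the spectral theorem. Let \<open>\<mu>\<close> be
  the infimum of \<open>\<parallel>A x\<parallel>\<^sup>2\<close> over unit vectors and \<open>T\<close> the matrix \<open>A\<^sup>* A - \<mu> I\<close>. Positivity of the form
  of \<open>T\<close> bounds \<open>\<parallel>T x\<parallel>\<^sup>2\<close> by a constant times \<open>\<parallel>A x\<parallel>\<^sup>2 - \<mu>\<close>, which is arbitrarily small. Hence \<open>T\<close> is
  singular and \<open>\<mu>\<close> is an eigenvalue of \<open>A\<^sup>* A\<close>.
\<close>

section \<open>Squared norms, adjoints and kernels of complex matrices\<close>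

lemma smult_zero_vec: "(c :: complex) \<cdot>\<^sub>v 0\<^sub>v n = 0\<^sub>v n"
  by (intro eq_vecI) auto

lemma zero_smult_vec: "x \<in> carrier_vec n \<Longrightarrow> (0 :: complex) \<cdot>\<^sub>v x = 0\<^sub>v n"
  by (intro eq_vecI) auto

text \<open>The product \<open>x \<bullet>c x\<close> has complex type; a real-valued version makes
  infima and order estimates available, and staying with squares avoids roots.\<close>

definition norm_sq :: "complex vec \<Rightarrow> real" where
  "norm_sq x = (\<Sum>i<dim_vec x. (cmod (x $ i))\<^sup>2)"

lemma cscalar_prod_self: "x \<bullet>c x = complex_of_real (norm_sq x)"
  by (simp add: scalar_prod_def norm_sq_def complex_norm_square atLeast0LessThan del: of_real_power)

lemma norm_sq_nonneg [simp]: "norm_sq x \<ge> 0"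
  by (simp add: norm_sq_def sum_nonneg)

lemma norm_sq_eq_0_iff: "norm_sq x = 0 \<longleftrightarrow> x = 0\<^sub>v (dim_vec x)"
  using conjugate_square_eq_0_vec[of x "dim_vec x"] cscalar_prod_self[of x] by auto

lemma norm_sq_smult: "norm_sq (c \<cdot>\<^sub>v x) = (cmod c)\<^sup>2 * norm_sq x"
  by (simp add: norm_sq_def norm_mult power_mult_distrib sum_distrib_left)

lemma norm_sq_diff_smult:
  assumes "x \<in> carrier_vec n" "y \<in> carrier_vec n"
  shows "norm_sq (x - complex_of_real t \<cdot>\<^sub>v y)
    = norm_sq x - 2 * t * Re (x \<bullet>c y) + t\<^sup>2 * norm_sq y"
proof -
  have *: "(cmod (a - of_real t * b))\<^sup>2 = (cmod a)\<^sup>2 - 2 * t * Re (a * cnj b) + t\<^sup>2 * (cmod b)\<^sup>2"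
    for a b :: complex
    by (simp add: cmod_power2) (simp add: power2_eq_square algebra_simps)
  show ?thesis
    using assms
    by (simp add: norm_sq_def scalar_prod_def * Re_sum sum.distrib sum_subtractf sum_distrib_left
        atLeast0LessThan del: complex_cnj times_complex.sel)
qed

lemma Re_cscalar_prod_commute:
  assumes "x \<in> carrier_vec n" "y \<in> carrier_vec n"
  shows "Re (x \<bullet>c y) = Re (y \<bullet>c x)"
  using assms by (simp add: scalar_prod_def Re_sum mult.commute)

lemma exists_unit_multiple:
  assumes "x \<in> carrier_vec n" "x \<noteq> 0\<^sub>v n"
  obtains c where "norm_sq (c \<cdot>\<^sub>v x) = 1"
proof
  have "norm_sq x \<noteq> 0" using assms norm_sq_eq_0_iff[of x] by auto
  then show "norm_sq (complex_of_real (1 / sqrt (norm_sq x)) \<cdot>\<^sub>v x) = 1"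
    by (simp add: norm_sq_smult norm_divide power_divide)
qed

lemma dim_mat_adjoint [simp]:
  "dim_row (mat_adjoint A) = dim_col A" "dim_col (mat_adjoint A) = dim_row A"
  by (simp_all add: mat_adjoint_def)

lemma mat_adjoint_carrier [simp]: "A \<in> carrier_mat m n \<Longrightarrow> mat_adjoint A \<in> carrier_mat n m"
  by (auto simp: mat_adjoint_def)

lemma mat_adjoint_index:
  "i < dim_col A \<Longrightarrow> j < dim_row A \<Longrightarrow> mat_adjoint A $$ (i, j) = conjugate (A $$ (j, i))"
  by (simp add: mat_adjoint_def mat_of_rows_def)

lemma cscalar_prod_mult_mat_vec:
  fixes A :: "complex mat"
  assumes "A \<in> carrier_mat m n" "x \<in> carrier_vec n" "y \<in> carrier_vec m"
  shows "(A *\<^sub>v x) \<bullet>c y = x \<bullet>c (mat_adjoint A *\<^sub>v y)"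
proof -
  have "(A *\<^sub>v x) \<bullet>c y = (\<Sum>i<m. \<Sum>j<n. A $$ (i, j) * x $ j * cnj (y $ i))"
    using assms by (simp add: scalar_prod_def atLeast0LessThan sum_distrib_right)
  also have "\<dots> = (\<Sum>j<n. \<Sum>i<m. A $$ (i, j) * x $ j * cnj (y $ i))"
    by (rule sum.swap)
  also have "\<dots> = x \<bullet>c (mat_adjoint A *\<^sub>v y)"
    using assms
    by (simp add: scalar_prod_def atLeast0LessThan sum_distrib_left mat_adjoint_index mult_ac)
  finally show ?thesis .
qed

lemma mult_mat_vec_bounded:
  assumes "A \<in> carrier_mat m n"
  obtains C where "C > 0" "\<And>x. x \<in> carrier_vec n \<Longrightarrow> norm_sq (A *\<^sub>v x) \<le> C * norm_sq x"
proof
  let ?C = "\<Sum>i<m. (\<Sum>j<n. cmod (A $$ (i, j)))\<^sup>2"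
  \<comment> \<open>The summand 1 keeps the constant positive even for the zero matrix; later
    estimates divide by it.\<close>
  show "1 + ?C > 0" by (simp add: sum_nonneg add_pos_nonneg)
  fix x :: "complex vec" assume x: "x \<in> carrier_vec n"
  have comp: "cmod (x $ j) \<le> sqrt (norm_sq x)" if "j < n" for j
    using x that member_le_sum[of j "{..<n}" "\<lambda>i. (cmod (x $ i))\<^sup>2"]
    by (intro real_le_rsqrt) (auto simp: norm_sq_def)
  have row: "(cmod ((A *\<^sub>v x) $ i))\<^sup>2 \<le> (\<Sum>j<n. cmod (A $$ (i, j)))\<^sup>2 * norm_sq x" if "i < m" for i
  proof -
    have "cmod ((A *\<^sub>v x) $ i) = cmod (\<Sum>j<n. A $$ (i, j) * x $ j)"
      using assms x that by (simp add: scalar_prod_def atLeast0LessThan)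
    also have "\<dots> \<le> (\<Sum>j<n. cmod (A $$ (i, j)) * sqrt (norm_sq x))"
      by (intro sum_norm_le) (auto simp: norm_mult intro!: mult_left_mono comp)
    finally have "(cmod ((A *\<^sub>v x) $ i))\<^sup>2 \<le> ((\<Sum>j<n. cmod (A $$ (i, j))) * sqrt (norm_sq x))\<^sup>2"
      by (intro power_mono) (auto simp: sum_distrib_right)
    then show ?thesis by (simp add: power_mult_distrib)
  qed
  have "norm_sq (A *\<^sub>v x) \<le> ?C * norm_sq x"
    using assms row by (auto simp: norm_sq_def[of "A *\<^sub>v x"] sum_distrib_right intro!: sum_mono)
  then show "norm_sq (A *\<^sub>v x) \<le> (1 + ?C) * norm_sq x"
    using norm_sq_nonneg[of x] unfolding distrib_right by linarith
qed

text \<open>The matrix is padded with zero rows to a singular square matrix.\<close>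

lemma wide_mat_kernel:
  fixes B :: "complex mat"
  assumes B: "B \<in> carrier_mat m n" and "m < n"
  obtains u where "u \<in> carrier_vec n" "u \<noteq> 0\<^sub>v n" "B *\<^sub>v u = 0\<^sub>v m"
proof -
  define D where "D = mat n n (\<lambda>(i, j). if i < m then B $$ (i, j) else 0)"
  have D: "D \<in> carrier_mat n n" by (simp add: D_def)
  \<comment> \<open>Indices start at 0, so row \<open>m\<close> of \<open>D\<close> is the first
    padding row, and the transpose annihilates the corresponding unit vector.\<close>
  have "D\<^sup>T *\<^sub>v unit_vec n m = 0\<^sub>v n"
    using \<open>m < n\<close> by (intro eq_vecI) (auto simp: D_def)
  moreover have "unit_vec n m \<noteq> (0\<^sub>v n :: complex vec)"
    using \<open>m < n\<close> by simp
  ultimately have "det D\<^sup>T = 0"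
    using D by (subst det_0_iff_vec_prod_zero_field[of _ n]) (auto intro!: exI[of _ "unit_vec n m"])
  then have "det D = 0" using D by (simp add: det_transpose)
  then obtain u where u: "u \<in> carrier_vec n" "u \<noteq> 0\<^sub>v n" "D *\<^sub>v u = 0\<^sub>v n"
    using det_0_iff_vec_prod_zero_field[OF D] by auto
  have "B *\<^sub>v u = 0\<^sub>v m"
  proof (rule eq_vecI)
    fix i assume "i < dim_vec (0\<^sub>v m :: complex vec)"
    then have i: "i < m" "i < n" using \<open>m < n\<close> by auto
    have "row B i = row D i" using B i by (intro eq_vecI) (auto simp: D_def)
    then have "(B *\<^sub>v u) $ i = (D *\<^sub>v u) $ i" using B D i by simp
    then show "(B *\<^sub>v u) $ i = 0\<^sub>v m $ i" using u i by simp
  qed (use B in auto)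
  with u that show thesis by blast
qed

text \<open>A zero singular value needs a left singular vector as well.\<close>

lemma adjoint_kernel:
  fixes A :: "complex mat"
  assumes A: "A \<in> carrier_mat m n" and "n \<le> m"
    and v: "v \<in> carrier_vec n" "v \<noteq> 0\<^sub>v n" "A *\<^sub>v v = 0\<^sub>v m"
  obtains u where "u \<in> carrier_vec m" "u \<noteq> 0\<^sub>v m" "mat_adjoint A *\<^sub>v u = 0\<^sub>v n"
proof (cases "n = m")
  case False
  \<comment> \<open>With strictly more rows than columns the adjoint is wide, so its kernel is
    nontrivial whatever \<open>v\<close> is.\<close>
  with wide_mat_kernel[OF mat_adjoint_carrier[OF A]] \<open>n \<le> m\<close> that show thesis by auto
next
  case True
  then have "det A\<^sup>T = 0"
    using A v det_0_iff_vec_prod_zero_field[of A n] by (auto simp: det_transpose)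
  moreover have "A\<^sup>T \<in> carrier_mat n n" using A True by simp
  ultimately obtain w where w: "w \<in> carrier_vec n" "w \<noteq> 0\<^sub>v n" "A\<^sup>T *\<^sub>v w = 0\<^sub>v n"
    using det_0_iff_vec_prod_zero_field by blast
  \<comment> \<open>The adjoint is the conjugated transpose, so conjugation carries the kernel of
    the transpose to that of the adjoint.\<close>
  have "mat_adjoint A *\<^sub>v conjugate w = conjugate (A\<^sup>T *\<^sub>v w)"
    using A True w(1)
    by (intro eq_vecI) (auto simp: scalar_prod_def mat_adjoint_index sum_conjugate conjugate_dist_mul)
  then show thesis using that[of "conjugate w"] w True by simp
qed

section \<open>Variational characterization of the smallest singular value\<close>

lemma minimal_gram_eigenvector:
  fixes A :: "complex mat"
  assumes A: "A \<in> carrier_mat m n" and n: "n > 0"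
  obtains \<mu> v where "\<mu> \<ge> 0" "v \<in> carrier_vec n" "norm_sq v = 1"
    "mat_adjoint A *\<^sub>v (A *\<^sub>v v) = complex_of_real \<mu> \<cdot>\<^sub>v v"
    "\<And>x. x \<in> carrier_vec n \<Longrightarrow> \<mu> * norm_sq x \<le> norm_sq (A *\<^sub>v x)"
proof -
  define S where "S = {norm_sq (A *\<^sub>v x) |x. x \<in> carrier_vec n \<and> norm_sq x = 1}"
  define \<mu> where "\<mu> = Inf S"
  define H where "H = mat_adjoint A * A"
  define T where "T = H + complex_of_real (- \<mu>) \<cdot>\<^sub>m 1\<^sub>m n"
  have Ad: "mat_adjoint A \<in> carrier_mat n m" using A by simp
  have H: "H \<in> carrier_mat n n" unfolding H_def using A Ad by auto
  have T: "T \<in> carrier_mat n n" unfolding T_def using H by simp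
  have Tx: "T *\<^sub>v x = mat_adjoint A *\<^sub>v (A *\<^sub>v x) - complex_of_real \<mu> \<cdot>\<^sub>v x"
    if "x \<in> carrier_vec n" for x
  proof -
    have "T *\<^sub>v x = H *\<^sub>v x + (complex_of_real (- \<mu>) \<cdot>\<^sub>m 1\<^sub>m n) *\<^sub>v x"
      unfolding T_def using H that by (intro add_mult_distrib_mat_vec) auto
    also have "(complex_of_real (- \<mu>) \<cdot>\<^sub>m 1\<^sub>m n) *\<^sub>v x = - (complex_of_real \<mu> \<cdot>\<^sub>v x)"
      using that by (intro eq_vecI) auto
    also have "H *\<^sub>v x = mat_adjoint A *\<^sub>v (A *\<^sub>v x)"
      unfolding H_def using A that by (intro assoc_mult_mat_vec[OF Ad]) auto
    finally show ?thesis using A Ad that by (intro eq_vecI) auto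
  qed
  \<comment> \<open>This is where \<open>n > 0\<close> enters: \<open>S\<close> is nonempty, so its
    infimum is meaningful.\<close>
  have unit: "norm_sq (unit_vec n 0) = 1"
    using n cscalar_prod_self[of "unit_vec n 0"] by (simp add: scalar_prod_left_unit)
  then have "S \<noteq> {}" using unit_vec_carrier unfolding S_def by blast
  have bdd: "bdd_below S" by (auto simp: S_def intro!: bdd_belowI[of _ 0])
  have "\<mu> \<ge> 0" unfolding \<mu>_def using \<open>S \<noteq> {}\<close> by (intro cInf_greatest) (auto simp: S_def)
  have lower: "\<mu> * norm_sq x \<le> norm_sq (A *\<^sub>v x)" if x: "x \<in> carrier_vec n" for x
  proof (cases "x = 0\<^sub>v n")
    case True
    then have "norm_sq x = 0" using norm_sq_eq_0_iff[of x] by simp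
    then show ?thesis by simp
  next
    case False
    then obtain c where c: "norm_sq (c \<cdot>\<^sub>v x) = 1" using exists_unit_multiple[OF x] by blast
    have "\<mu> \<le> norm_sq (A *\<^sub>v (c \<cdot>\<^sub>v x))"
      unfolding \<mu>_def using bdd c x by (intro cInf_lower) (auto simp: S_def)
    also have "\<dots> = (cmod c)\<^sup>2 * norm_sq (A *\<^sub>v x)"
      using A x by (simp add: mult_mat_vec norm_sq_smult)
    finally have "\<mu> * norm_sq (c \<cdot>\<^sub>v x) \<le> (cmod c)\<^sup>2 * norm_sq (A *\<^sub>v x)" by (simp add: c)
    moreover have "(cmod c)\<^sup>2 > 0" using c by (auto simp: norm_sq_smult)
    ultimately show ?thesis by (simp add: norm_sq_smult mult.left_commute)
  qed
  obtain C where C: "C > 0" "\<And>x. x \<in> carrier_vec n \<Longrightarrow> norm_sq (A *\<^sub>v x) \<le> C * norm_sq x"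
    using mult_mat_vec_bounded[OF A] by blast
  text \<open>Evaluate the nonnegative form \<open>norm_sq (A *\<^sub>v x) - \<mu> * norm_sq x\<close> at
    \<open>x - (1 / C) T x\<close>.\<close>
  have residual: "norm_sq (T *\<^sub>v x) \<le> C * (norm_sq (A *\<^sub>v x) - \<mu> * norm_sq x)"
    if x: "x \<in> carrier_vec n" for x
  proof -
    define y where "y = T *\<^sub>v x"
    \<comment> \<open>The choice \<open>t = 1 / C\<close> minimizes
      \<open>C * t\<^sup>2 - 2 * t\<close>, with minimal value \<open>- 1 / C\<close>.\<close>
    define t where "t = 1 / C"
    have y: "y \<in> carrier_vec n" using T x by (simp add: y_def)
    have z: "x - complex_of_real t \<cdot>\<^sub>v y \<in> carrier_vec n" using x y by simp
    \<comment> \<open>The left side is the real part of the sesquilinear form of \<open>T\<close> at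
      \<open>x\<close> and \<open>y\<close>, that is, of the product of \<open>T *\<^sub>v x\<close>
      with \<open>y\<close>; these two vectors coincide.\<close>
    have Re_y: "Re ((A *\<^sub>v x) \<bullet>c (A *\<^sub>v y)) - \<mu> * Re (x \<bullet>c y) = norm_sq y"
    proof -
      have "(A *\<^sub>v y) \<bullet>c (A *\<^sub>v x) = y \<bullet>c (mat_adjoint A *\<^sub>v (A *\<^sub>v x))"
        using A x y by (intro cscalar_prod_mult_mat_vec) auto
      then have "Re ((A *\<^sub>v x) \<bullet>c (A *\<^sub>v y)) = Re ((mat_adjoint A *\<^sub>v (A *\<^sub>v x)) \<bullet>c y)"
        using A Ad x y Re_cscalar_prod_commute[of "A *\<^sub>v x" m "A *\<^sub>v y"]
          Re_cscalar_prod_commute[of "mat_adjoint A *\<^sub>v (A *\<^sub>v x)" n y] mult_mat_vec_carrier[OF Ad, of "A *\<^sub>v x"]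
        by simp
      moreover have "norm_sq y = Re (y \<bullet>c y)" by (simp add: cscalar_prod_self)
      moreover have "y \<bullet>c y = (mat_adjoint A *\<^sub>v (A *\<^sub>v x)) \<bullet>c y - complex_of_real \<mu> * (x \<bullet>c y)"
        using x y A mult_mat_vec_carrier[OF Ad, of "A *\<^sub>v x"]
        by (simp add: y_def[unfolded Tx[OF x]] minus_scalar_prod_distrib[of _ n])
      ultimately show ?thesis by simp
    qed
    have Az: "A *\<^sub>v (x - complex_of_real t \<cdot>\<^sub>v y) = A *\<^sub>v x - complex_of_real t \<cdot>\<^sub>v (A *\<^sub>v y)"
      using A x y by (simp add: mult_minus_distrib_mat_vec[of A m n] mult_mat_vec)
    have Ax: "A *\<^sub>v x \<in> carrier_vec m" and Ay: "A *\<^sub>v y \<in> carrier_vec m" using A x y by auto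
    have "0 \<le> norm_sq (A *\<^sub>v x) - 2 * t * Re ((A *\<^sub>v x) \<bullet>c (A *\<^sub>v y)) + t\<^sup>2 * norm_sq (A *\<^sub>v y)
        - \<mu> * (norm_sq x - 2 * t * Re (x \<bullet>c y) + t\<^sup>2 * norm_sq y)"
      using lower[OF z] unfolding Az norm_sq_diff_smult[OF x y] norm_sq_diff_smult[OF Ax Ay]
      by simp
    also have "\<dots> = norm_sq (A *\<^sub>v x) - \<mu> * norm_sq x - 2 * t * norm_sq y
        + t\<^sup>2 * norm_sq (A *\<^sub>v y) - \<mu> * t\<^sup>2 * norm_sq y"
      unfolding Re_y[symmetric] by (simp add: algebra_simps)
    also have "\<dots> \<le> norm_sq (A *\<^sub>v x) - \<mu> * norm_sq x - 2 * t * norm_sq y + t\<^sup>2 * (C * norm_sq y)"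
    proof -
      have "t\<^sup>2 * norm_sq (A *\<^sub>v y) \<le> t\<^sup>2 * (C * norm_sq y)"
        using C(2)[OF y] by (intro mult_left_mono) auto
      moreover have "0 \<le> \<mu> * t\<^sup>2 * norm_sq y" using \<open>\<mu> \<ge> 0\<close> by simp
      ultimately show ?thesis by linarith
    qed
    also have "\<dots> = norm_sq (A *\<^sub>v x) - \<mu> * norm_sq x - norm_sq y / C"
      using C(1) by (simp add: t_def power2_eq_square field_simps)
    finally show ?thesis using C(1) by (simp add: y_def field_simps)
  qed
  have "det T = 0"
  proof (rule ccontr)
    assume "det T \<noteq> 0"
    then obtain G where G: "G \<in> carrier_mat n n" "G * T = 1\<^sub>m n"
      using det_non_zero_imp_unit[OF T] unfolding Units_def ring_mat_def by auto
    obtain D where D: "D > 0" "\<And>x. x \<in> carrier_vec n \<Longrightarrow> norm_sq (G *\<^sub>v x) \<le> D * norm_sq x"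
      using mult_mat_vec_bounded[OF G(1)] by blast
    \<comment> \<open>The margin is the reciprocal of the product of the two constants in the
      estimate below, which therefore ends in 1 < 1.\<close>
    have "Inf S < \<mu> + 1 / (D * C)" using C D by (simp add: \<mu>_def)
    then obtain s where "s \<in> S" "s < \<mu> + 1 / (D * C)"
      using cInf_lessD[OF \<open>S \<noteq> {}\<close>] by blast
    then obtain x where x: "x \<in> carrier_vec n" "norm_sq x = 1"
      and less: "norm_sq (A *\<^sub>v x) < \<mu> + 1 / (D * C)"
      by (auto simp: S_def)
    have "x = G *\<^sub>v (T *\<^sub>v x)" using G T x by (simp flip: assoc_mult_mat_vec)
    then have "1 \<le> D * norm_sq (T *\<^sub>v x)" using D(2)[of "T *\<^sub>v x"] T x by simp
    also have "\<dots> \<le> D * (C * (norm_sq (A *\<^sub>v x) - \<mu>))"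
      using residual[OF x(1)] x(2) D(1) by (intro mult_left_mono) auto
    also have "\<dots> < D * (C * (1 / (D * C)))"
      using less C(1) D(1) by (intro mult_strict_left_mono) auto
    also have "\<dots> = 1" using C(1) D(1) by simp
    finally show False by simp
  qed
  then obtain x where x: "x \<in> carrier_vec n" "x \<noteq> 0\<^sub>v n" "T *\<^sub>v x = 0\<^sub>v n"
    using det_0_iff_vec_prod_zero_field[OF T] by auto
  obtain c where c: "norm_sq (c \<cdot>\<^sub>v x) = 1" using exists_unit_multiple[OF x(1,2)] by blast
  have cx: "c \<cdot>\<^sub>v x \<in> carrier_vec n" using x by simp
  have T0: "T *\<^sub>v (c \<cdot>\<^sub>v x) = 0\<^sub>v n"
    using T x by (simp add: mult_mat_vec smult_zero_vec)
  have "mat_adjoint A *\<^sub>v (A *\<^sub>v (c \<cdot>\<^sub>v x)) = complex_of_real \<mu> \<cdot>\<^sub>v (c \<cdot>\<^sub>v x)" (is "?a = ?b")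
  proof (rule eq_vecI)
    fix i assume "i < dim_vec ?b"
    then show "?a $ i = ?b $ i"
      using arg_cong[OF T0, of "\<lambda>v. v $ i"] A Ad x unfolding Tx[OF cx] by simp
  qed (use Ad x in auto)
  with that \<open>\<mu> \<ge> 0\<close> cx c lower show thesis by blast
qed

lemma singular_triple_norm_sq:
  assumes "singular_triple A s u v"
  shows "norm_sq v = 1" "norm_sq (A *\<^sub>v v) = s\<^sup>2"
proof -
  have "norm_sq u = 1" "norm_sq v = 1" "A *\<^sub>v v = complex_of_real s \<cdot>\<^sub>v u"
    using assms by (auto simp: singular_triple_def cscalar_prod_self)
  then show "norm_sq v = 1" "norm_sq (A *\<^sub>v v) = s\<^sup>2" by (simp_all add: norm_sq_smult)
qed

text \<open>The squares of singular values are eigenvalues of the Gram matrix, and squaring is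
  injective on nonnegative reals. Finiteness is what makes \<open>Min\<close> in
  \<open>sigma_min\<close> meaningful.\<close>

lemma finite_singular_values: "finite {s. \<exists>u v. singular_triple A s u v}" (is "finite ?S")
proof -
  let ?H = "mat_adjoint A * A"
  have H: "?H \<in> carrier_mat (dim_col A) (dim_col A)"
    by auto
  have "eigenvalue ?H (complex_of_real (s\<^sup>2))" if "singular_triple A s u v" for s u v
  proof -
    note st = that[unfolded singular_triple_def]
    have "?H *\<^sub>v v = mat_adjoint A *\<^sub>v (A *\<^sub>v v)"
      using st by (intro assoc_mult_mat_vec[of _ _ "dim_row A" _ "dim_col A"]) auto
    also have "\<dots> = complex_of_real s \<cdot>\<^sub>v (complex_of_real s \<cdot>\<^sub>v v)"
      using st by (simp add: mult_mat_vec[of _ "dim_col A" "dim_row A"])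
    also have "\<dots> = complex_of_real (s\<^sup>2) \<cdot>\<^sub>v v"
      by (simp add: smult_smult_assoc power2_eq_square)
    finally have "?H *\<^sub>v v = complex_of_real (s\<^sup>2) \<cdot>\<^sub>v v" .
    moreover have "v \<noteq> 0\<^sub>v (dim_col A)" using st by auto
    ultimately show ?thesis
      using st H unfolding eigenvalue_def eigenvector_def by auto
  qed
  then have "(\<lambda>s. complex_of_real (s\<^sup>2)) ` ?S \<subseteq> spectrum ?H"
    by (auto simp: spectrum_def)
  then have "finite ((\<lambda>s. complex_of_real (s\<^sup>2)) ` ?S)"
    using card_finite_spectrum(1)[OF H] finite_subset by blast
  moreover have "inj_on (\<lambda>s. complex_of_real (s\<^sup>2)) ?S"
    by (auto simp: inj_on_def singular_triple_def simp del: of_real_power)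
  ultimately show ?thesis by (rule finite_imageD)
qed

text \<open>The shape conditions matter. Without columns there are no unit vectors and hence no
  singular values; a wide matrix has a nontrivial kernel although its \<open>sigma_min\<close> may
  be positive, so the last bound can fail.\<close>

lemma sigma_min_properties:
  assumes A: "A \<in> carrier_mat m n" and "0 < n" "n \<le> m"
  shows sigma_min_nonneg: "0 \<le> sigma_min A"
    and sigma_min_attained: "\<exists>v. min_right_singular_vector A v"
    and sigma_min_le: "\<And>x. x \<in> carrier_vec n \<Longrightarrow> (sigma_min A)\<^sup>2 * norm_sq x \<le> norm_sq (A *\<^sub>v x)"
proof -
  let ?S = "{s. \<exists>u v. singular_triple A s u v}"
  obtain \<mu> v where \<mu>: "\<mu> \<ge> 0" and v: "v \<in> carrier_vec n" "norm_sq v = 1"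
    and ev: "mat_adjoint A *\<^sub>v (A *\<^sub>v v) = complex_of_real \<mu> \<cdot>\<^sub>v v"
    and low: "\<And>x. x \<in> carrier_vec n \<Longrightarrow> \<mu> * norm_sq x \<le> norm_sq (A *\<^sub>v x)"
    using minimal_gram_eigenvector[OF A \<open>0 < n\<close>] by blast
  define s where "s = sqrt \<mu>"
  have s: "s \<ge> 0" "s\<^sup>2 = \<mu>" using \<mu> by (simp_all add: s_def)
  have Ad: "mat_adjoint A \<in> carrier_mat n m" using A by simp
  have Av: "A *\<^sub>v v \<in> carrier_vec m" using A v by simp
  have "complex_of_real (norm_sq (A *\<^sub>v v)) = v \<bullet>c (mat_adjoint A *\<^sub>v (A *\<^sub>v v))"
    using A v by (simp flip: cscalar_prod_self add: cscalar_prod_mult_mat_vec)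
  also have "\<dots> = complex_of_real \<mu>"
    using v unfolding ev by (simp add: conjugate_smult_vec cscalar_prod_self)
  finally have nAv: "norm_sq (A *\<^sub>v v) = \<mu>" by (simp only: of_real_eq_iff)
  obtain u where u: "u \<in> carrier_vec m" "norm_sq u = 1" "A *\<^sub>v v = complex_of_real s \<cdot>\<^sub>v u"
    "mat_adjoint A *\<^sub>v u = complex_of_real s \<cdot>\<^sub>v v"
  \<comment> \<open>For positive \<mu> the left vector is the image of \<open>v\<close> divided by
    \<open>s\<close>. For \<mu> = 0 this image vanishes, and a unit vector in the kernel of the
    adjoint takes its place.\<close>
  proof (cases "\<mu> = 0")
    case True
    then have Av0: "A *\<^sub>v v = 0\<^sub>v m" using nAv norm_sq_eq_0_iff[of "A *\<^sub>v v"] A by simp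
    have "v \<noteq> 0\<^sub>v n" using v norm_sq_eq_0_iff[of v] by auto
    then obtain y where y: "y \<in> carrier_vec m" "y \<noteq> 0\<^sub>v m" "mat_adjoint A *\<^sub>v y = 0\<^sub>v n"
      using adjoint_kernel[OF A \<open>n \<le> m\<close> v(1) _ Av0] by blast
    obtain c where "norm_sq (c \<cdot>\<^sub>v y) = 1" using exists_unit_multiple[OF y(1,2)] by blast
    then show thesis
      using that[of "c \<cdot>\<^sub>v y"] y Av0 v True Ad
      by (simp add: s_def mult_mat_vec smult_zero_vec zero_smult_vec[of _ m] zero_smult_vec[of _ n])
  next
    case False
    then have "s > 0" using \<mu> by (simp add: s_def)
    then show thesis
      using that[of "complex_of_real (1 / s) \<cdot>\<^sub>v (A *\<^sub>v v)"] Av Ad ev s nAv False v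
      by (simp add: norm_sq_smult mult_mat_vec smult_smult_assoc norm_divide power_divide
          power2_eq_square flip: s(2))
  qed
  have st: "singular_triple A s u v"
    using A u v s by (auto simp: singular_triple_def cscalar_prod_self)
  have "sigma_min A = s"
    unfolding sigma_min_def
  proof (rule Min_eqI)
    \<comment> \<open>Every singular value is the norm of the image of a unit vector, so
      \<open>low\<close> bounds its square below by \<mu>.\<close>
    fix s' assume "s' \<in> ?S"
    then obtain u' v' where st': "singular_triple A s' u' v'" by blast
    then have "s' \<ge> 0" "v' \<in> carrier_vec n" using A by (auto simp: singular_triple_def)
    with low[of v'] singular_triple_norm_sq[OF st'] s show "s \<le> s'"
      by (auto intro: power2_le_imp_le)
  qed (use st finite_singular_values in auto)
  with st s low show "0 \<le> sigma_min A" "\<exists>v. min_right_singular_vector A v"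
    "\<And>x. x \<in> carrier_vec n \<Longrightarrow> (sigma_min A)\<^sup>2 * norm_sq x \<le> norm_sq (A *\<^sub>v x)"
    by (auto simp: min_right_singular_vector_def)
qed

section \<open>Restriction to the range of an isometry\<close>

lemma isometry_norm_sq:
  assumes V: "V \<in> carrier_mat n r" "mat_adjoint V * V = 1\<^sub>m r" and x: "x \<in> carrier_vec r"
  shows "norm_sq (V *\<^sub>v x) = norm_sq x"
proof -
  have "(V *\<^sub>v x) \<bullet>c (V *\<^sub>v x) = x \<bullet>c ((mat_adjoint V * V) *\<^sub>v x)"
    using V(1) x by (simp add: cscalar_prod_mult_mat_vec[of V n r] assoc_mult_mat_vec[of _ r n])
  then show ?thesis using V(2) x by (simp add: cscalar_prod_self)
qed

text \<open>An isometry is injective, and a wide matrix is not. This supplies the shape condition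
  under which \<open>sigma_min_properties\<close> applies to \<open>B * V\<close>.\<close>

lemma isometry_dim:
  fixes V :: "complex mat"
  assumes V: "V \<in> carrier_mat n r" "mat_adjoint V * V = 1\<^sub>m r"
  shows "r \<le> n"
proof (rule ccontr)
  assume "\<not> r \<le> n"
  then obtain x where x: "x \<in> carrier_vec r" "x \<noteq> 0\<^sub>v r" "V *\<^sub>v x = 0\<^sub>v n"
    using wide_mat_kernel[OF V(1)] by auto
  then have "norm_sq x = 0"
    using isometry_norm_sq[OF V x(1)] norm_sq_eq_0_iff[of "V *\<^sub>v x"] by simp
  with x show False using norm_sq_eq_0_iff[of x] by simp
qed

text \<open>A minimizing unit vector for \<open>B * V\<close> is sent by \<open>V\<close> to a unit
  vector that competes for \<open>B\<close> with the same value.\<close>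

lemma sigma_min_mult_isometry_ge:
  assumes B: "B \<in> carrier_mat n n" and V: "V \<in> carrier_mat n r" "mat_adjoint V * V = 1\<^sub>m r"
    and "r > 0"
  shows "sigma_min B \<le> sigma_min (B * V)"
proof -
  note r = isometry_dim[OF V]
  have BV: "B * V \<in> carrier_mat n r" using B V by simp
  obtain v where v: "min_right_singular_vector (B * V) v"
    using sigma_min_attained[OF BV \<open>r > 0\<close> r] by blast
  then obtain u where st: "singular_triple (B * V) (sigma_min (B * V)) u v"
    by (auto simp: min_right_singular_vector_def)
  have vc: "v \<in> carrier_vec r" using st V by (simp add: singular_triple_def)
  have "norm_sq (V *\<^sub>v v) = 1"
    using isometry_norm_sq[OF V vc] singular_triple_norm_sq[OF st] by simp
  then have "(sigma_min B)\<^sup>2 \<le> norm_sq (B *\<^sub>v (V *\<^sub>v v))"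
    using sigma_min_le[OF B _ order_refl, of "V *\<^sub>v v"] \<open>r > 0\<close> r V vc by simp
  also have "B *\<^sub>v (V *\<^sub>v v) = (B * V) *\<^sub>v v" using B V vc by simp
  finally show ?thesis
    using singular_triple_norm_sq[OF st] sigma_min_nonneg[OF BV \<open>r > 0\<close> r]
    by (auto intro: power2_le_imp_le)
qed

text \<open>If a minimizing vector for \<open>B\<close> lies in the range of \<open>V\<close>, its
  coordinate vector is a unit vector and competes for \<open>B * V\<close>.\<close>

lemma sigma_min_mult_isometry_le:
  assumes B: "B \<in> carrier_mat n n" and V: "V \<in> carrier_mat n r" "mat_adjoint V * V = 1\<^sub>m r"
    and "r > 0" and v: "min_right_singular_vector B (V *\<^sub>v x)" and x: "x \<in> carrier_vec r"
  shows "sigma_min (B * V) \<le> sigma_min B"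
proof -
  note r = isometry_dim[OF V]
  have BV: "B * V \<in> carrier_mat n r" using B V by simp
  obtain u where st: "singular_triple B (sigma_min B) u (V *\<^sub>v x)"
    using v by (auto simp: min_right_singular_vector_def)
  have "norm_sq x = 1" using isometry_norm_sq[OF V x] singular_triple_norm_sq[OF st] by simp
  then have "(sigma_min (B * V))\<^sup>2 \<le> norm_sq ((B * V) *\<^sub>v x)"
    using sigma_min_le[OF BV \<open>r > 0\<close> r x] by simp
  also have "(B * V) *\<^sub>v x = B *\<^sub>v (V *\<^sub>v x)" using B V x by simp
  finally show ?thesis
    using singular_triple_norm_sq[OF st] sigma_min_nonneg[OF B _ order_refl] \<open>r > 0\<close> r
    by (auto intro: power2_le_imp_le)
qed

section \<open>Comparison of the abscissae and the repeated iterate\<close>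

text \<open>The threshold \<open>\<epsilon> * p_weight w (cmod z)\<close> is common to both
  problems, so larger smallest singular values give a smaller pseudospectrum. If it becomes empty,
  its supremum in \<open>ereal\<close> is still a lower bound.\<close>

lemma abscissa_reduced_le:
  assumes "\<And>z. P z x \<in> carrier_mat n n"
    and "V \<in> carrier_mat n r" "mat_adjoint V * V = 1\<^sub>m r" "r > 0"
  shows "pseudospectral_abscissa (reduced_matpoly P V) \<epsilon> w x \<le> pseudospectral_abscissa P \<epsilon> w x"
  unfolding pseudospectral_abscissa_def
proof (rule SUP_subset_mono)
  show "pseudospectrum (reduced_matpoly P V) \<epsilon> w x \<subseteq> pseudospectrum P \<epsilon> w x"
    using sigma_min_mult_isometry_ge[OF assms] order_trans
    unfolding pseudospectrum_def reduced_matpoly_def by blast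
qed simp

text \<open>The singular vector at the rightmost point lies in the range of \<open>V\<close>, so
  this point stays in the reduced pseudospectrum, and one point suffices to bound the supremum from
  below.\<close>

lemma abscissa_le_reduced:
  assumes "P z x \<in> carrier_mat n n"
    and "V \<in> carrier_mat n r" "mat_adjoint V * V = 1\<^sub>m r" "r > 0"
    and "rightmost_point P \<epsilon> w x z"
    and "min_right_singular_vector (P z x) (V *\<^sub>v y)" "y \<in> carrier_vec r"
  shows "pseudospectral_abscissa P \<epsilon> w x \<le> pseudospectral_abscissa (reduced_matpoly P V) \<epsilon> w x"
proof -
  have "sigma_min (P z x * V) \<le> sigma_min (P z x)"
    using assms by (intro sigma_min_mult_isometry_le) auto
  then have "z \<in> pseudospectrum (reduced_matpoly P V) \<epsilon> w x"
    using assms(5) by (simp add: rightmost_point_def pseudospectrum_def reduced_matpoly_def)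
  then have "ereal (Re z) \<le> pseudospectral_abscissa (reduced_matpoly P V) \<epsilon> w x"
    unfolding pseudospectral_abscissa_def by (rule SUP_upper)
  then show ?thesis using assms(5) by (simp add: rightmost_point_def)
qed

theorem theorem4p3:
  fixes n qm qc qk \<eta> l k :: nat
    and \<Omega> \<Omega>' :: "(real ^ 'd) set"
    and \<epsilon> wm wc wk :: real
    and w :: "real \<times> real \<times> real"
    and \<psi> \<zeta> \<kappa> :: "nat \<Rightarrow> real ^ 'd \<Rightarrow> real"
    and Mi Cj Kl :: "nat \<Rightarrow> complex mat"
    and P :: "complex \<Rightarrow> real ^ 'd \<Rightarrow> complex mat"
    and \<nu>\<^sub>0 \<nu> :: "nat \<Rightarrow> real ^ 'd"
    and z\<^sub>0 z :: "nat \<Rightarrow> complex"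
    and v\<^sub>0 v :: "nat \<Rightarrow> complex vec"
    and V :: "nat \<Rightarrow> complex mat"
  assumes n: "n \<ge> 1"
    and domain: "open \<Omega>" "compact \<Omega>'" "\<Omega>' \<subseteq> \<Omega>"
    and eps: "\<epsilon> > 0"
    and weights: "wm \<ge> 0" "wc \<ge> 0" "wk \<ge> 0" "w = (wm, wc, wk)"
    and Mi: "\<And>i. i < qm \<Longrightarrow> Mi i \<in> carrier_mat n n \<and> real_analytic_on (\<psi> i) \<Omega>"
    and Cj: "\<And>i. i < qc \<Longrightarrow> Cj i \<in> carrier_mat n n \<and> real_analytic_on (\<zeta> i) \<Omega>"
    and Kl: "\<And>i. i < qk \<Longrightarrow> Kl i \<in> carrier_mat n n \<and> real_analytic_on (\<kappa> i) \<Omega>"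
    and P: "P = quad_matpoly (param_mat n qm \<psi> Mi) (param_mat n qc \<zeta> Cj) (param_mat n qk \<kappa> Kl)"
    and bounded: "\<And>x. x \<in> \<Omega>' \<Longrightarrow> bounded (pseudospectrum P \<epsilon> w x)"
    and init: "\<eta> \<ge> 1"
      "\<And>j. j \<in> {1..\<eta>} \<Longrightarrow> \<nu>\<^sub>0 j \<in> \<Omega>'"
      "\<And>j. j \<in> {1..\<eta>} \<Longrightarrow> rightmost_point P \<epsilon> w (\<nu>\<^sub>0 j) (z\<^sub>0 j)"
      "\<And>j. j \<in> {1..\<eta>} \<Longrightarrow> min_right_singular_vector (P (z\<^sub>0 j) (\<nu>\<^sub>0 j)) (v\<^sub>0 j)"
      "onb_matrix n (V 0) (cspan n (v\<^sub>0 ` {1..\<eta>}))"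
    and step:
      "\<And>i. i \<ge> 1 \<Longrightarrow> is_arg_min (pseudospectral_abscissa (reduced_matpoly P (V (i - 1))) \<epsilon> w)
          (\<lambda>x. x \<in> \<Omega>') (\<nu> i)"
      "\<And>i. i \<ge> 1 \<Longrightarrow> rightmost_point P \<epsilon> w (\<nu> i) (z i)"
      "\<And>i. i \<ge> 1 \<Longrightarrow> min_right_singular_vector (P (z i) (\<nu> i)) (v i)"
      "\<And>i. i \<ge> 1 \<Longrightarrow> onb_matrix n (V i) (cspan n (set (cols (V (i - 1)) @ [v i])))"
    and eq: "1 \<le> l" "l < k" "\<nu> l = \<nu> k"
  shows "is_arg_min (pseudospectral_abscissa P \<epsilon> w) (\<lambda>x. x \<in> \<Omega>') (\<nu> l)"
proof -
  interpret vec_space "TYPE(complex)" n .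
  have carr: "P a x \<in> carrier_mat n n" for a x
    by (simp add: P quad_matpoly_def param_mat_def)
  have Vdim: "dim_row (V i) = n" "mat_adjoint (V i) * V i = 1\<^sub>m (dim_col (V i))" for i
    using init(5) step(4)[of i] by (cases "i = 0"; auto simp: onb_matrix_def)+
  have colsV: "set (cols (V i)) \<subseteq> carrier_vec n" for i
    using cols_dim[of "V i"] Vdim by simp
  have vc: "v i \<in> carrier_vec n" if "i \<ge> 1" for i
    using step(3)[OF that] carr[of "z i" "\<nu> i"]
    by (auto simp: min_right_singular_vector_def singular_triple_def)
  have span_step: "span (set (cols (V (Suc i)))) = span (set (cols (V i) @ [v (Suc i)]))" for i
    using step(4)[of "Suc i"] by (simp add: onb_matrix_def)
  have incr: "span (set (cols (V i))) \<subseteq> span (set (cols (V (Suc i))))" for i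
    unfolding span_step by (rule span_is_monotone) auto
  have "v l \<in> span (set (cols (V (l - 1)) @ [v l]))"
    using colsV vc[OF eq(1)] by (intro span_mem) auto
  then have "v l \<in> span (set (cols (V l)))"
    using span_step[of "l - 1"] eq(1) by simp
  \<comment> \<open>The subspace that determines \<open>\<nu> k\<close> has index
    \<open>k - 1\<close>; since \<open>l < k\<close> gives \<open>l \<le> k - 1\<close>, nestedness
    already places \<open>v l\<close> in it.\<close>
  also have "\<dots> \<subseteq> span (set (cols (V (k - 1))))"
    using lift_Suc_mono_le[of "\<lambda>i. span (set (cols (V i)))", OF incr] eq by simp
  finally have "v l \<in> col_space (V (k - 1))" by (simp add: col_space_def)
  define W where "W = V (k - 1)"
  define r where "r = dim_col W"
  have W: "W \<in> carrier_mat n r" "mat_adjoint W * W = 1\<^sub>m r"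
    using Vdim[of "k - 1"] by (auto simp: W_def r_def)
  obtain y where y: "y \<in> carrier_vec r" "v l = W *\<^sub>v y"
    using \<open>v l \<in> col_space (V (k - 1))\<close> col_space_eq[OF W(1)] by (auto simp: W_def r_def)
  \<comment> \<open>A unit vector in the range of \<open>W\<close> forces at least one column, as
    the comparison lemmas require.\<close>
  have "norm_sq (v l) = 1"
    using step(3)[OF eq(1)] singular_triple_norm_sq by (auto simp: min_right_singular_vector_def)
  then have "norm_sq y = 1" using isometry_norm_sq[OF W y(1)] y(2) by simp
  then have r: "r > 0" using y(1) by (cases "r = 0") (auto simp: norm_sq_def)
  have opt: "\<nu> k \<in> \<Omega>'" "\<And>x. x \<in> \<Omega>' \<Longrightarrow> pseudospectral_abscissa (reduced_matpoly P W) \<epsilon> w (\<nu> k)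
      \<le> pseudospectral_abscissa (reduced_matpoly P W) \<epsilon> w x"
    using step(1)[of k] eq by (auto simp: is_arg_min_linorder W_def)
  have "pseudospectral_abscissa P \<epsilon> w (\<nu> l) \<le> pseudospectral_abscissa P \<epsilon> w x" if "x \<in> \<Omega>'" for x
  proof -
    have "pseudospectral_abscissa P \<epsilon> w (\<nu> l) \<le> pseudospectral_abscissa (reduced_matpoly P W) \<epsilon> w (\<nu> l)"
      using step(2,3)[OF eq(1)] y by (intro abscissa_le_reduced[of P "z l" "\<nu> l", OF carr W r]) auto
    \<comment> \<open>Optimality is known for \<open>\<nu> k\<close> and the reduction by
      \<open>W\<close>; the coincidence of the iterates transfers it to
      \<open>\<nu> l\<close>.\<close>
    also have "\<dots> \<le> pseudospectral_abscissa (reduced_matpoly P W) \<epsilon> w x"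
      using opt(2)[OF that] eq(3) by simp
    also have "\<dots> \<le> pseudospectral_abscissa P \<epsilon> w x"
      by (rule abscissa_reduced_le[of P, OF carr W r])
    finally show ?thesis .
  qed
  then show ?thesis using opt(1) eq(3) by (simp add: is_arg_min_linorder)
qed

end
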